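(* Let $\mathbf t$ be the Thue--Morse word, $P_{\mathbf t}(n)=\sum_{i=0}^{n-1}p_{\mathbf t}(i)$ and $h_{\mathbf t}(n)=P_{\mathbf t}(n)/n$ for $n\ge1$. There exists a $1$-periodic continuous function $\Phi:\mathbb R\to\mathbb C$ such that \[ P_{\mathbf t}(n)=n^2\,\Phi(\{\log_2 n\})+O(n\log n) \quad\text{and}\quad h_{\mathbf t}(n)=n\,\Phi(\{\log_2 n\})+O(\log n)\] as $n\to\infty$.
   Context: The Thue--Morse word $\mathbf t=t_0t_1t_2\cdots$ over $\{0,1\}$ is defined by $t_i=0$ if the number of $1$'s in the binary representation of $i$ is even, and $t_i=1$ otherwise. For an infinite word $\mathbf w=w_0w_1w_2\cdots$, the periodicity function $p_{\mathbf w}(i)$ is the length of the shortest nonempty prefix $u$ of $w_iw_{i+1}w_{i+2}\cdots$ such that either $u$ is a suffix of $w_0\cdots w_{i-1}$ or $w_0\cdots w_{i-1}$ is a suffix of $u$ (for $i=0$, $w_0\cdots w_{i-1}$ is the empty word). For a real number $z$, $\{z\}$ denotes its fractional part. *)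

theory Defs
  imports Complex_Main "HOL-Library.Sublist" "HOL-Library.Landau_Symbols"
begin

definition thue_morse :: "nat \<Rightarrow> nat" where
  "thue_morse i = (if even (card {k. bit i k}) then 0 else 1)"

definition factor :: "(nat \<Rightarrow> 'a) \<Rightarrow> nat \<Rightarrow> nat \<Rightarrow> 'a list" where
  "factor w i j = map w [i..<j]"

(* The nonempty prefixes u of w_i w_(i+1) ... are the words factor w i (i + l) with l > 0.
   If no admissible l exists (this can happen only for words that are not recurrent,
   so not for the Thue-Morse word), the value is unspecified. *)
definition periodicity :: "(nat \<Rightarrow> 'a) \<Rightarrow> nat \<Rightarrow> nat" where
  "periodicity w i = (LEAST l. l > 0 \<and>
     (suffix (factor w i (i + l)) (factor w 0 i) \<or> suffix (factor w 0 i) (factor w i (i + l))))"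

definition periodicity_sum :: "(nat \<Rightarrow> 'a) \<Rightarrow> nat \<Rightarrow> nat" where
  "periodicity_sum w n = (\<Sum>i<n. periodicity w i)"

definition periodicity_mean :: "(nat \<Rightarrow> 'a) \<Rightarrow> nat \<Rightarrow> real" where
  "periodicity_mean w n = real (periodicity_sum w n) / real n"

end

theory Submission imports Defs begin

text \<open>
  At an even position \<open>j\<close> the periodicity is at most \<open>2\<close>, because the two blocks of length 2 that
  meet at \<open>j\<close> are both \<open>01\<close> or \<open>10\<close>. At an odd position \<open>j\<close> with \<open>2 ^ k \<le> j < 2 ^ (k + 1)\<close> it equals
  \<open>3 * 2 ^ k\<close>: a square centred at \<open>j\<close> would have even period and desubstitute to an overlap, so the
  whole prefix of length \<open>j\<close> has to reoccur, and its first reoccurrence is at \<open>3 * 2 ^ k\<close>.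
  Summation gives \<open>3 / 2 * 2 ^ k * n - 4 ^ k\<close> up to \<open>O(n)\<close> for \<open>2 ^ k \<le> n \<le> 2 ^ (k + 1)\<close>, which is
  \<open>n\<^sup>2 * \<Phi> (frac (log 2 n))\<close> with \<open>\<Phi> x = 3 / 2 * 2 powr - x - 4 powr - x\<close> on \<open>[0, 1]\<close>;
  \<open>\<Phi>\<close> takes the value \<open>1 / 2\<close> at both ends.
\<close>

section \<open>Periodicity in terms of local periods\<close>

lemma suffix_iff_nth:
  "suffix xs ys \<longleftrightarrow> length xs \<le> length ys \<and>
     (\<forall>i<length xs. xs ! i = ys ! (length ys - length xs + i))"
proof
  assume "suffix xs ys"
  then show "length xs \<le> length ys \<and>
     (\<forall>i<length xs. xs ! i = ys ! (length ys - length xs + i))"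
    by (auto simp: suffix_def nth_append)
next
  assume *: "length xs \<le> length ys \<and>
     (\<forall>i<length xs. xs ! i = ys ! (length ys - length xs + i))"
  then have "xs = drop (length ys - length xs) ys"
    by (intro nth_equalityI) auto
  then show "suffix xs ys"
    by (metis suffix_drop)
qed

text \<open>Only pairs straddling \<open>i\<close> are compared, which merges the two suffix
  alternatives: for \<open>l \<le> i\<close> a square is centred at \<open>i\<close>, for
  \<open>i \<le> l\<close> the whole prefix of length \<open>i\<close> reoccurs at
  \<open>l\<close>.\<close>

definition local_period :: "(nat \<Rightarrow> 'a) \<Rightarrow> nat \<Rightarrow> nat \<Rightarrow> bool" where
  "local_period w i l \<longleftrightarrow> l > 0 \<and> (\<forall>s<i. i \<le> s + l \<longrightarrow> w s = w (s + l))"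

lemma local_period_iff_suffix:
  "local_period w i l \<longleftrightarrow> l > 0 \<and>
     (suffix (factor w i (i + l)) (factor w 0 i) \<or> suffix (factor w 0 i) (factor w i (i + l)))"
proof -
  have 1: "suffix (factor w i (i + l)) (factor w 0 i) \<longleftrightarrow>
      l \<le> i \<and> (\<forall>s<i. i \<le> s + l \<longrightarrow> w s = w (s + l))"
  proof (cases "l \<le> i")
    case True
    have "(\<forall>m<l. w (i + m) = w (i - l + m)) \<longleftrightarrow> (\<forall>s<i. i \<le> s + l \<longrightarrow> w s = w (s + l))"
    proof (intro iffI allI impI)
      fix s assume *: "\<forall>m<l. w (i + m) = w (i - l + m)" and s: "s < i" "i \<le> s + l"
      have "s + l - i < l" using s by auto
      with * have "w (i + (s + l - i)) = w (i - l + (s + l - i))" by blast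
      moreover have "i + (s + l - i) = s + l" "i - l + (s + l - i) = s" using s True by auto
      ultimately show "w s = w (s + l)" by simp
    next
      fix m assume *: "\<forall>s<i. i \<le> s + l \<longrightarrow> w s = w (s + l)" and m: "m < l"
      have "i - l + m < i" "i \<le> i - l + m + l" using m True by auto
      with * have "w (i - l + m) = w (i - l + m + l)" by blast
      moreover have "i - l + m + l = i + m" using True by simp
      ultimately show "w (i + m) = w (i - l + m)" by simp
    qed
    then show ?thesis using True by (simp add: suffix_iff_nth factor_def)
  next
    case False
    then show ?thesis by (simp add: suffix_iff_nth factor_def)
  qed
  have 2: "suffix (factor w 0 i) (factor w i (i + l)) \<longleftrightarrow>
      i \<le> l \<and> (\<forall>s<i. i \<le> s + l \<longrightarrow> w s = w (s + l))"
  proof (cases "i \<le> l")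
    case True
    have "i + (l - i + s) = s + l" for s using True by simp
    then show ?thesis using True
      by (simp add: suffix_iff_nth factor_def add.commute[of _ l])
  next
    case False
    then show ?thesis by (simp add: suffix_iff_nth factor_def)
  qed
  show ?thesis unfolding 1 2 local_period_def by auto
qed

lemma periodicity_eq_Least: "periodicity w i = (LEAST l. local_period w i l)"
  unfolding periodicity_def local_period_iff_suffix ..

lemma periodicity_le: "local_period w i l \<Longrightarrow> periodicity w i \<le> l"
  unfolding periodicity_eq_Least by (rule Least_le)

lemma periodicity_eqI:
  assumes "local_period w i l" and "\<And>m. local_period w i m \<Longrightarrow> l \<le> m"
  shows "periodicity w i = l"
  unfolding periodicity_eq_Least using assms by (rule Least_equality)

section \<open>Binary recursion of the Thue-Morse word\<close>

lemma thue_morse_0 [simp]: "thue_morse 0 = 0"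
  by (simp add: thue_morse_def)

lemma thue_morse_double [simp]: "thue_morse (2 * n) = thue_morse n"
proof -
  have "{k. bit (2 * n) k} = Suc ` {k. bit n k}"
  proof (rule set_eqI)
    fix k show "k \<in> {k. bit (2 * n) k} \<longleftrightarrow> k \<in> Suc ` {k. bit n k}"
      by (cases k) (auto simp: bit_Suc bit_0)
  qed
  then show ?thesis by (simp add: thue_morse_def card_image)
qed

text \<open>Needed at odd arguments, where inserting bit 0 must raise the cardinality by exactly
  one.\<close>

lemma finite_bits_nat: "finite {k. bit (n::nat) k}"
proof (rule finite_subset)
  show "{k. bit n k} \<subseteq> {..<n}"
  proof (clarsimp, rule ccontr)
    fix k assume "bit n k" and "\<not> k < n"
    then have "n < 2 ^ k" by (meson less_exp less_le_trans not_less order_le_less_trans)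
    with \<open>bit n k\<close> show False by (simp add: bit_iff_odd)
  qed
qed simp

lemma thue_morse_Suc_double [simp]: "thue_morse (Suc (2 * n)) = 1 - thue_morse n"
proof -
  have "{k. bit (Suc (2 * n)) k} = insert 0 (Suc ` {k. bit n k})"
  proof (rule set_eqI)
    fix k show "k \<in> {k. bit (Suc (2 * n)) k} \<longleftrightarrow> k \<in> insert 0 (Suc ` {k. bit n k})"
      by (cases k) (auto simp: bit_Suc bit_0)
  qed
  then show ?thesis
    by (simp add: thue_morse_def card_image finite_bits_nat)
qed

lemma thue_morse_le_1: "thue_morse n \<le> 1"
  by (simp add: thue_morse_def)

text \<open>Subtraction on \<open>nat\<close> is truncated, so cancelling the flip relies on letters
  being at most 1.\<close>

lemma thue_morse_flip_eq_iff:
  "1 - thue_morse m = 1 - thue_morse n \<longleftrightarrow> thue_morse m = thue_morse n"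
  using thue_morse_le_1[of m] thue_morse_le_1[of n] by auto

section \<open>Overlaps, and squares centred at odd positions\<close>

lemma thue_morse_even_neq_Suc: "even n \<Longrightarrow> thue_morse (Suc n) \<noteq> thue_morse n"
proof (elim evenE)
  fix m assume "n = 2 * m"
  then show ?thesis using thue_morse_le_1[of m] by simp presburger
qed

text \<open>Exactly one of \<open>s\<close> and \<open>s + l\<close> is even, and a letter at an even position differs from the next.\<close>

lemma thue_morse_odd_shift_neq_Suc:
  assumes "odd l" "thue_morse s = thue_morse (s + l)" "thue_morse (Suc s) = thue_morse (Suc s + l)"
  shows "thue_morse (Suc s) \<noteq> thue_morse s"
  using assms thue_morse_even_neq_Suc[of s] thue_morse_even_neq_Suc[of "s + l"]
  by (cases "even s") auto

text \<open>Over two letters, a run without equal neighbours is determined by its first letter. This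
  settles odd periods, which force such runs.\<close>

lemma thue_morse_alternating:
  assumes "\<And>m. m < r \<Longrightarrow> thue_morse (Suc (a + m)) \<noteq> thue_morse (a + m)"
  shows "thue_morse (a + r) = thue_morse a \<longleftrightarrow> even r"
  using assms
proof (induction r)
  case (Suc r)
  have "thue_morse (a + r) = thue_morse a \<longleftrightarrow> even r" using Suc by simp
  moreover have "thue_morse (Suc (a + r)) \<noteq> thue_morse (a + r)" using Suc by simp
  ultimately show ?case
    using thue_morse_le_1[of "Suc (a + r)"] thue_morse_le_1[of "a + r"] thue_morse_le_1[of a]
    by auto
qed simp

text \<open>Desubstitution: both positions have the same parity, so both letters arise from their
  halves by the same injective map, identity or flip.\<close>

lemma thue_morse_even_shift:
  assumes "thue_morse s = thue_morse (s + 2 * l)"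
  shows "thue_morse (s div 2) = thue_morse (s div 2 + l)"
proof (cases "even s")
  case True
  then obtain q where "s = 2 * q" by (elim evenE)
  with assms show ?thesis using thue_morse_double[of "q + l"] by simp
next
  case False
  then obtain q where "s = Suc (2 * q)" by (metis oddE Suc_eq_plus1)
  with assms have "1 - thue_morse q = 1 - thue_morse (q + l)"
    using thue_morse_Suc_double[of "q + l"] by simp
  with \<open>s = Suc (2 * q)\<close> show ?thesis by (simp add: thue_morse_flip_eq_iff del: One_nat_def)
qed

text \<open>An even period halves, which also moves the start, so \<open>a\<close> is generalised.
  An odd period forces alternation, so letters at distance \<open>l\<close> differ.\<close>

lemma thue_morse_overlap_free:
  assumes "l > 0"
  shows "\<exists>s. a \<le> s \<and> s \<le> a + l \<and> thue_morse s \<noteq> thue_morse (s + l)"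
  using assms
proof (induction l arbitrary: a rule: less_induct)
  case (less l)
  show ?case
  proof (rule ccontr)
    assume "\<not> ?case"
    then have eq: "thue_morse s = thue_morse (s + l)" if "a \<le> s" "s \<le> a + l" for s
      using that by blast
    show False
    proof (cases "even l")
      case True
      then obtain h where h: "l = 2 * h" by (elim evenE)
      with less.prems have "h < l" "h > 0" by auto
      from less.IH[OF this] obtain s where s: "a div 2 \<le> s" "s \<le> a div 2 + h" "thue_morse s \<noteq> thue_morse (s + h)" by blast
      \<comment> \<open>A preimage of \<open>s\<close> under halving inside the window;
        \<open>2 * s\<close> falls outside only if \<open>a = Suc (2 * s)\<close>.\<close>
      define u where "u = (if a \<le> 2 * s then 2 * s else Suc (2 * s))"
      have "a \<le> u" "u \<le> a + l" "u div 2 = s"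
        using s(1,2) h unfolding u_def by (auto split: if_splits)
      then show False using eq[of u] thue_morse_even_shift[of u h] s(3) h by auto
    next
      case False
      have "thue_morse (a + l) = thue_morse a \<longleftrightarrow> even l"
        using thue_morse_odd_shift_neq_Suc[OF False] eq by (intro thue_morse_alternating) auto
      with False eq[of a] show False by simp
    qed
  qed
qed

lemma thue_morse_no_square_centred_at_odd:
  assumes "odd j" "l > 0" "l \<le> j"
  shows "\<not> local_period thue_morse j l"
proof
  assume "local_period thue_morse j l"
  then have eq: "thue_morse s = thue_morse (s + l)" if "s < j" "j \<le> s + l" for s
    using that unfolding local_period_def by blast
  show False
  proof (cases "even l")
    case True
    then obtain h where h: "l = 2 * h" by (elim evenE)
    from assms(1) obtain i where j: "j = Suc (2 * i)" by (metis oddE Suc_eq_plus1)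
    obtain s where s: "i - h \<le> s" "s \<le> i - h + h" "thue_morse s \<noteq> thue_morse (s + h)"
      using thue_morse_overlap_free[of h "i - h"] h assms(2) by auto
    have "h \<le> i" using assms(3) h j by simp
    \<comment> \<open>The positions \<open>j - l\<close> to \<open>j - 1\<close> have the
      \<open>h + 1\<close> halves \<open>i - h\<close> to \<open>i\<close>, enough for an overlap.
      At \<open>s = i\<close> only the even preimage lies below \<open>j\<close>; at
      \<open>s = i - h\<close> only the odd one reaches \<open>j - l\<close>.\<close>
    define u where "u = (if s = i then 2 * s else Suc (2 * s))"
    have "u < j" "j \<le> u + l" "u div 2 = s"
      using s(1,2) \<open>h \<le> i\<close> h j assms(2) unfolding u_def by (auto split: if_splits)
    then show False using eq[of u] thue_morse_even_shift[of u h] s(3) h by auto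
  next
    case False
    \<comment> \<open>Alternation from \<open>j - l\<close> to \<open>j - 1\<close> makes the
      letters at \<open>j - 1\<close> and \<open>j - l\<close> equal, and the latter equals the
      letter at \<open>j\<close>; but \<open>j - 1\<close> is even.\<close>
    have "thue_morse (j - l + (l - 1)) = thue_morse (j - l) \<longleftrightarrow> even (l - 1)"
    proof (intro thue_morse_alternating thue_morse_odd_shift_neq_Suc[OF False] eq)
    qed (use assms in auto)
    moreover have "j - l + (l - 1) = j - 1" "Suc (j - 1) = j" using assms by auto
    moreover have "thue_morse (j - l) = thue_morse j" using eq[of "j - l"] assms by simp
    moreover have "thue_morse (Suc (j - 1)) \<noteq> thue_morse (j - 1)"
      using assms by (intro thue_morse_even_neq_Suc) auto
    ultimately show False using False by simp
  qed
qed

section \<open>First reoccurrence of prefixes\<close>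

lemma thue_morse_small:
  "thue_morse 1 = 1" "thue_morse 2 = 1" "thue_morse 3 = 0" "thue_morse 4 = 1"
proof -
  show 1: "thue_morse 1 = 1" using thue_morse_Suc_double[of 0] by simp
  show 2: "thue_morse 2 = 1" using thue_morse_double[of 1] 1 by simp
  show "thue_morse 3 = 0" using thue_morse_Suc_double[of 1] 1 by (simp add: numeral_3_eq_3)
  show "thue_morse 4 = 1" using thue_morse_double[of 2] 2 by simp
qed

text \<open>For \<open>k > 0\<close> the equal letters at 1 and 2 exclude odd shifts, so the shift
  halves. The last letter of the \<open>2 ^ k + 1\<close> matters: \<open>01\<close> alone already
  reoccurs at 3, before 6.\<close>

lemma thue_morse_first_return:
  assumes "l > 0" "\<And>s. s \<le> 2 ^ k \<Longrightarrow> thue_morse s = thue_morse (s + l)"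
  shows "3 * 2 ^ k \<le> l"
  using assms
proof (induction k arbitrary: l)
  case 0
  have "l \<noteq> 1" "l \<noteq> 2" using 0(2)[of 0] thue_morse_small by auto
  with 0(1) show ?case by simp
next
  case (Suc k)
  have "even l"
  proof (rule ccontr)
    assume "odd l"
    have "(2::nat) \<le> 2 ^ Suc k" by simp
    then have "thue_morse 1 = thue_morse (1 + l)" "thue_morse 2 = thue_morse (2 + l)"
      by (intro Suc.prems(2); linarith)+
    then have "thue_morse (Suc 1) \<noteq> thue_morse 1"
      by (intro thue_morse_odd_shift_neq_Suc[OF \<open>odd l\<close>]) (simp_all add: numeral_2_eq_2)
    then show False using thue_morse_small by (simp flip: numeral_2_eq_2)
  qed
  then obtain h where h: "l = 2 * h" by (elim evenE)
  have "3 * 2 ^ k \<le> h"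
  proof (rule Suc.IH)
    show "h > 0" using Suc.prems h by simp
    fix s :: nat assume "s \<le> 2 ^ k"
    then show "thue_morse s = thue_morse (s + h)"
      using Suc.prems(2)[of "2 * s"] thue_morse_even_shift[of "2 * s" h] h by simp
  qed
  then show ?case using h by simp
qed

text \<open>The prefix \<open>01\<close> reoccurs at 3; applying the substitution \<open>k\<close>
  times scales this.\<close>

lemma thue_morse_add_3_power:
  "s < 2 ^ Suc k \<Longrightarrow> thue_morse (s + 3 * 2 ^ k) = thue_morse s"
proof (induction k arbitrary: s)
  case 0
  then have "s = 0 \<or> s = 1" by auto
  then show ?case using thue_morse_small by auto
next
  case (Suc k)
  define q where "q = s div 2"
  have q: "thue_morse (q + 3 * 2 ^ k) = thue_morse q"
    using Suc.prems unfolding q_def by (intro Suc.IH) auto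
  consider "s = 2 * q" | "s = Suc (2 * q)" unfolding q_def by linarith
  then show ?case
  proof cases
    case 1
    then have "s + 3 * 2 ^ Suc k = 2 * (q + 3 * 2 ^ k)" by simp
    then show ?thesis using q 1 by (simp only: thue_morse_double)
  next
    case 2
    then have "s + 3 * 2 ^ Suc k = Suc (2 * (q + 3 * 2 ^ k))" by simp
    then show ?thesis using q 2 by (simp only: thue_morse_Suc_double)
  qed
qed

section \<open>Values of the periodicity function\<close>

lemma periodicity_thue_morse_odd:
  assumes "odd j" "2 ^ k \<le> j" "j < 2 ^ Suc k"
  shows "periodicity thue_morse j = 3 * 2 ^ k"
proof (rule periodicity_eqI)
  show "local_period thue_morse j (3 * 2 ^ k)"
    using assms thue_morse_add_3_power[of _ k] by (simp add: local_period_def)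
next
  fix l assume l: "local_period thue_morse j l"
  then have "l > 0" by (simp add: local_period_def)
  with l assms(1) have "j < l"
    using thue_morse_no_square_centred_at_odd[of j l] by force
  then have eq: "thue_morse s = thue_morse (s + l)" if "s < j" for s
    using l that by (simp add: local_period_def)
  show "3 * 2 ^ k \<le> l"
  \<comment> \<open>For \<open>k = 0\<close> the prefix has one letter, too few for
    \<open>thue_morse_first_return\<close>. For \<open>k > 0\<close> an odd \<open>j\<close> exceeds
    \<open>2 ^ k\<close>, which supplies the extra letter.\<close>
  proof (cases k)
    case 0
    have "l \<noteq> 1" "l \<noteq> 2"
      using eq[of 0] thue_morse_small assms(2) by (auto simp: odd_pos[OF assms(1)])
    then show ?thesis using 0 \<open>l > 0\<close> by simp
  next
    case (Suc m)
    then have "j \<noteq> 2 ^ k" using assms(1) by auto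
    with assms(2) have "s < j" if "s \<le> 2 ^ k" for s using that by simp
    with eq \<open>l > 0\<close> show ?thesis by (intro thue_morse_first_return) auto
  qed
qed

text \<open>If the letters on both sides of \<open>j\<close> agree, 1 is a period (vacuously at
  \<open>j = 0\<close>). If they differ, the two blocks meeting at \<open>j\<close> come from equal
  letters, so 2 is a period.\<close>

lemma periodicity_thue_morse_even:
  assumes "even j"
  shows "periodicity thue_morse j \<le> 2"
proof (cases "j = 0 \<or> thue_morse (j - 1) = thue_morse j")
  case True
  then have "local_period thue_morse j 1"
    unfolding local_period_def by (auto simp: less_Suc_eq_le le_Suc_eq)
  then show ?thesis using periodicity_le by fastforce
next
  case False
  with assms obtain i where j: "j = Suc (Suc (2 * i))"
    by (metis evenE mult_Suc_right add_2_eq_Suc mult_0_right not0_implies_Suc)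
  have "thue_morse (2 * i) = thue_morse (2 * i + 2)"
    using False thue_morse_le_1[of i] thue_morse_le_1[of "Suc i"] j
      thue_morse_Suc_double[of i] thue_morse_double[of "Suc i"] by auto
  moreover from this have "thue_morse (Suc (2 * i)) = thue_morse (Suc (2 * i) + 2)"
    using thue_morse_Suc_double[of "Suc i"] thue_morse_double[of "Suc i"] by simp
  moreover have "s = 2 * i \<or> s = Suc (2 * i)" if "s < j" "j \<le> s + 2" for s
    using that j by auto
  ultimately have "thue_morse s = thue_morse (s + 2)" if "s < j" "j \<le> s + 2" for s
    using that by metis
  then have "local_period thue_morse j 2"
    unfolding local_period_def by simp
  then show ?thesis by (rule periodicity_le)
qed

section \<open>Partial sums on dyadic blocks\<close>

lemma periodicity_sum_thue_morse_level:
  assumes "k > 0" "2 * r \<le> 2 ^ k"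
  shows "periodicity_sum thue_morse (2 ^ k) + 3 * 2 ^ k * r \<le> periodicity_sum thue_morse (2 ^ k + 2 * r)"
    and "periodicity_sum thue_morse (2 ^ k + 2 * r)
      \<le> periodicity_sum thue_morse (2 ^ k) + 3 * 2 ^ k * r + 2 * r"
proof -
  have "periodicity_sum thue_morse (2 ^ k) + 3 * 2 ^ k * r \<le> periodicity_sum thue_morse (2 ^ k + 2 * r)
    \<and> periodicity_sum thue_morse (2 ^ k + 2 * r)
      \<le> periodicity_sum thue_morse (2 ^ k) + 3 * 2 ^ k * r + 2 * r"
    using assms(2)
  proof (induction r)
    case (Suc r)
    have "periodicity thue_morse (Suc (2 ^ k + 2 * r)) = 3 * 2 ^ k"
      using Suc.prems assms(1) by (intro periodicity_thue_morse_odd) auto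
    moreover have "periodicity thue_morse (2 ^ k + 2 * r) \<le> 2"
      using assms(1) by (intro periodicity_thue_morse_even) auto
    ultimately show ?case using Suc by (simp add: periodicity_sum_def)
  qed simp
  then show "periodicity_sum thue_morse (2 ^ k) + 3 * 2 ^ k * r
        \<le> periodicity_sum thue_morse (2 ^ k + 2 * r)"
    and "periodicity_sum thue_morse (2 ^ k + 2 * r)
      \<le> periodicity_sum thue_morse (2 ^ k) + 3 * 2 ^ k * r + 2 * r" by auto
qed

text \<open>Taking \<open>2 * r = 2 ^ k\<close> in the level bounds adds \<open>3 * 4 ^ k\<close> to
  the doubled sum, and the error term doubles. The induction starts at \<open>k = 1\<close>, where
  the sum is 4.\<close>

lemma periodicity_sum_thue_morse_power:
  assumes "k > 0"
  shows "4 ^ k \<le> 2 * periodicity_sum thue_morse (2 ^ k) \<and>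
    2 * periodicity_sum thue_morse (2 ^ k) \<le> 4 ^ k + 2 * 2 ^ k"
  using assms
proof (induction k)
  case (Suc k)
  show ?case
  proof (cases "k = 0")
    case True
    have "periodicity thue_morse 0 = 1"
      by (intro periodicity_eqI) (auto simp: local_period_def)
    moreover have "periodicity thue_morse 1 = 3"
      using periodicity_thue_morse_odd[of 1 0] by simp
    ultimately show ?thesis
      using True by (simp add: periodicity_sum_def numeral_2_eq_2)
  next
    case False
    then obtain m where m: "k = Suc m" by (cases k) auto
    have "(4::nat) ^ k = 2 ^ k * 2 ^ k"
      by (simp flip: power_mult_distrib)
    with Suc.IH periodicity_sum_thue_morse_level[of k "2 ^ m"] m
    show ?thesis by (simp add: mult_2[symmetric])
  qed
qed simp

lemma periodicity_sum_thue_morse_bound: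
  assumes "k > 0" "2 ^ k \<le> n" "n < 2 ^ Suc k"
  shows "\<bar>real (periodicity_sum thue_morse n) - (3 / 2 * 2 ^ k * real n - 4 ^ k)\<bar> \<le> 4 * real n"
proof -
  let ?P = "\<lambda>n. real (periodicity_sum thue_morse n)"
  define r where "r = (n - 2 ^ k) div 2"
  define e where "e = (n - 2 ^ k) mod 2"
  have n: "n = 2 ^ k + 2 * r + e" and e: "e = 0 \<or> e = 1"
    using assms(2) unfolding r_def e_def by auto
  have r: "2 * r \<le> 2 ^ k" using n assms(3) by simp
  have four: "(4::real) ^ k = 2 ^ k * 2 ^ k"
    by (simp flip: power_mult_distrib)
  have "real (4 ^ k) \<le> real (2 * periodicity_sum thue_morse (2 ^ k))"
    "real (2 * periodicity_sum thue_morse (2 ^ k)) \<le> real (4 ^ k + 2 * 2 ^ k)"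
    using periodicity_sum_thue_morse_power[OF assms(1)] by (simp_all only: of_nat_le_iff)
  then have 1: "4 ^ k \<le> 2 * ?P (2 ^ k)" "2 * ?P (2 ^ k) \<le> 4 ^ k + 2 * 2 ^ k" by simp_all
  have "real (periodicity_sum thue_morse (2 ^ k) + 3 * 2 ^ k * r)
      \<le> ?P (2 ^ k + 2 * r)"
    "?P (2 ^ k + 2 * r) \<le> real (periodicity_sum thue_morse (2 ^ k) + 3 * 2 ^ k * r + 2 * r)"
    using periodicity_sum_thue_morse_level[OF assms(1) r] by (simp_all only: of_nat_le_iff)
  then have 2: "?P (2 ^ k) + 3 * (2 ^ k * real r) \<le> ?P (2 ^ k + 2 * r)"
    "?P (2 ^ k + 2 * r) \<le> ?P (2 ^ k) + 3 * (2 ^ k * real r) + 2 * real r" by simp_all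
  have "periodicity thue_morse (2 ^ k + 2 * r) \<le> 2"
    using assms(1) by (intro periodicity_thue_morse_even) auto
  then have 3: "?P (2 ^ k + 2 * r) \<le> ?P n" "?P n \<le> ?P (2 ^ k + 2 * r) + 2 * real e"
    using e n by (auto simp: periodicity_sum_def)
  have N: "real n = 2 ^ k + 2 * real r + real e" using n by simp
  \<comment> \<open>Beyond the main terms of the bounds above, only the parity remainder
    \<open>e\<close> contributes, by at most \<open>3 / 2 * 2 ^ k\<close>; the linear error absorbs
    it.\<close>
  have "3 / 2 * 2 ^ k * real n - 4 ^ k
      = 4 ^ k / 2 + 3 * (2 ^ k * real r) + 3 / 2 * (2 ^ k * real e)"
    unfolding N four by (simp add: algebra_simps)
  moreover have "0 \<le> 2 ^ k * real e" "2 ^ k * real e \<le> 2 ^ k" using e by auto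
  moreover have "real r \<ge> 0" "real e \<ge> 0" by auto
  ultimately show ?thesis using 1 2 3 N by linarith
qed

section \<open>The limit function\<close>

definition limit_profile :: "real \<Rightarrow> real" where
  "limit_profile x = 3 / 2 * 2 powr - frac x - 4 powr - frac x"

lemma limit_profile_plus_1: "limit_profile (x + 1) = limit_profile x"
  by (simp add: limit_profile_def frac_def)

text \<open>On each closed \<open>[m, m + 1]\<close> one continuous formula applies, because the
  jump of \<open>frac\<close> at the right end is harmless:
  \<open>3 / 2 - 1 = 3 / 4 - 1 / 4\<close>. Adjacent intervals are then glued.\<close>

lemma continuous_limit_profile: "continuous_on UNIV limit_profile"
proof -
  have on_Icc: "limit_profile y
      = 3 / 2 * 2 powr - (y - of_int m) - 4 powr - (y - of_int m)"
    if "y \<in> {of_int m..of_int m + 1}" for y :: real and m :: int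
  proof (cases "y = of_int m + 1")
    case True
    then show ?thesis by (simp add: limit_profile_def frac_def powr_minus)
  next
    case False
    with that have "\<lfloor>y\<rfloor> = m" by (simp add: floor_eq_iff)
    then show ?thesis by (simp add: limit_profile_def frac_def)
  qed
  have cont: "continuous_on {of_int m..of_int m + 1} limit_profile" for m :: int
    by (subst continuous_on_cong[OF refl on_Icc]) (auto intro!: continuous_intros)
  have "isCont limit_profile x" for x
  proof -
    \<comment> \<open>This gives \<open>m < x \<le> m + 1\<close>, so an integer \<open>x\<close> is
      also interior to the glued interval; the floor would put it on the boundary.\<close>
    define m where "m = \<lceil>x\<rceil> - 1"
    have "continuous_on ({of_int m..of_int m + 1} \<union> {of_int (m + 1)..of_int (m + 1) + 1}) limit_profile"
      by (intro continuous_on_closed_Un cont closed_atLeastAtMost)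
    moreover have "{of_int m<..<of_int m + 2 :: real}
        \<subseteq> {of_int m..of_int m + 1} \<union> {of_int (m + 1)..of_int (m + 1) + 1}" by auto
    ultimately have "continuous_on {of_int m<..<of_int m + 2} limit_profile"
      by (rule continuous_on_subset)
    moreover have "x \<in> {of_int m<..<of_int m + 2}"
      unfolding m_def greaterThanLessThan_iff of_int_diff of_int_1
      using ceiling_correct[of x] by linarith
    ultimately show ?thesis
      using continuous_on_eq_continuous_at[OF open_greaterThanLessThan] by blast
  qed
  then show ?thesis by (simp add: continuous_at_imp_continuous_on)
qed

text \<open>On this block the floor of \<open>log 2 n\<close> is \<open>k\<close>, so
  \<open>2 powr - frac (log 2 n)\<close> is \<open>2 ^ k / n\<close>, and the identity is
  exact.\<close>

lemma limit_profile_frac_log: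
  assumes "2 ^ k \<le> n" "n < 2 ^ Suc k"
  shows "(real n)\<^sup>2 * limit_profile (frac (log 2 (real n))) = 3 / 2 * 2 ^ k * real n - 4 ^ k"
proof -
  have n: "n > 0" using assms(1) by (metis gr0I not_le zero_less_numeral zero_less_power)
  have "real (2 ^ k) \<le> real n" "real n < real (2 ^ Suc k)"
    using assms by (simp_all only: of_nat_le_iff of_nat_less_iff)
  then have "2 powr real_of_int (int k) \<le> real n" "real n < 2 powr real_of_int (int k + 1)"
    by (simp_all add: powr_realpow powr_add mult.commute)
  then have "\<lfloor>log 2 (real n)\<rfloor> = int k"
    using n by (simp add: floor_log_eq_powr_iff)
  then have f: "frac (log 2 (real n)) = log 2 (real n) - real k" by (simp add: frac_def)
  have 2: "2 powr - (log 2 (real n) - real k) = 2 ^ k / real n"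
    using n by (simp add: powr_diff powr_realpow)
  have "4 powr - x = (2 powr - x)\<^sup>2" for x :: real
    using powr_mult[of 2 2 "- x"] by (simp add: power2_eq_square)
  then have 4: "4 powr - (log 2 (real n) - real k) = (2 ^ k / real n)\<^sup>2" using 2 by metis
  have "(2 ^ k)\<^sup>2 = (4::real) ^ k" by (simp add: power2_eq_square flip: power_mult_distrib)
  then show ?thesis
    unfolding limit_profile_def frac_frac unfolding f 2 4 using n
    by (simp add: field_simps power2_eq_square)
qed

section \<open>Asymptotics of the sum and of the mean\<close>

lemma periodicity_sum_thue_morse_asymp:
  assumes "n \<ge> 2"
  shows "\<bar>real (periodicity_sum thue_morse n)
    - (real n)\<^sup>2 * limit_profile (frac (log 2 (real n)))\<bar> \<le> 4 * real n"
proof -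
  obtain k where k: "2 ^ k \<le> n" "n < 2 ^ (k + 1)"
    using ex_power_ivl1[of 2 n] assms by auto
  moreover have "k > 0" using k assms by (cases k) auto
  ultimately show ?thesis
    using periodicity_sum_thue_morse_bound[of k n] limit_profile_frac_log[of k n] by simp
qed

theorem theorem5:
  "\<exists>\<Phi> :: real \<Rightarrow> complex.
     (\<forall>x. \<Phi> (x + 1) = \<Phi> x) \<and> continuous_on UNIV \<Phi> \<and>
     (\<lambda>n. of_nat (periodicity_sum thue_morse n)
            - of_nat n ^ 2 * \<Phi> (frac (log 2 (real n))))
       \<in> O(\<lambda>n. of_real (real n * ln (real n))) \<and>
     (\<lambda>n. of_real (periodicity_mean thue_morse n)
            - of_nat n * \<Phi> (frac (log 2 (real n))))
       \<in> O(\<lambda>n. of_real (ln (real n)))"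
proof (intro exI[of _ "\<lambda>x. complex_of_real (limit_profile x)"] conjI allI)
  fix x show "complex_of_real (limit_profile (x + 1)) = complex_of_real (limit_profile x)"
    by (simp add: limit_profile_plus_1)
next
  show "continuous_on UNIV (\<lambda>x. complex_of_real (limit_profile x))"
    by (intro continuous_on_of_real continuous_limit_profile)
next
  let ?L = "\<lambda>n. limit_profile (frac (log 2 (real n)))"
  \<comment> \<open>The errors obtained are at most \<open>4 * n\<close> and 4; from 3 on, where
    \<open>n\<close> exceeds Euler's number, the logarithm only enlarges these bounds.\<close>
  have ln_ge: "1 \<le> ln (real n)" if "n \<ge> 3" for n
    using that exp_le by (subst ln_ge_iff) auto
  show "(\<lambda>n. of_nat (periodicity_sum thue_morse n) - of_nat n ^ 2 * complex_of_real (?L n))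
       \<in> O(\<lambda>n. of_real (real n * ln (real n)))"
  proof (intro bigoI[where c = 4] eventually_sequentiallyI[of 3])
    fix n :: nat assume n: "n \<ge> 3"
    have "of_nat (periodicity_sum thue_morse n) - of_nat n ^ 2 * complex_of_real (?L n)
        = complex_of_real (real (periodicity_sum thue_morse n) - (real n)\<^sup>2 * ?L n)" by simp
    also have "norm \<dots> \<le> 4 * real n"
      unfolding norm_of_real using periodicity_sum_thue_morse_asymp[of n] n by simp
    also have "\<dots> \<le> 4 * (real n * ln (real n))"
      using mult_left_mono[OF ln_ge[OF n], of "real n"] by simp
    also have "\<dots> = 4 * norm (complex_of_real (real n * ln (real n)))"
      unfolding norm_of_real using ln_ge[OF n] by simp
    finally show "norm (of_nat (periodicity_sum thue_morse n) - of_nat n ^ 2 * complex_of_real (?L n))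
      \<le> 4 * norm (complex_of_real (real n * ln (real n)))" .
  qed
  show "(\<lambda>n. of_real (periodicity_mean thue_morse n) - of_nat n * complex_of_real (?L n))
       \<in> O(\<lambda>n. of_real (ln (real n)))"
  proof (intro bigoI[where c = 4] eventually_sequentiallyI[of 3])
    fix n :: nat assume n: "n \<ge> 3"
    have "periodicity_mean thue_morse n - real n * ?L n
        = (real (periodicity_sum thue_morse n) - (real n)\<^sup>2 * ?L n) / real n"
      using n by (simp add: periodicity_mean_def field_simps power2_eq_square)
    then have "\<bar>periodicity_mean thue_morse n - real n * ?L n\<bar> \<le> 4"
      using periodicity_sum_thue_morse_asymp[of n] n by (simp add: divide_le_eq)
    then have "norm (complex_of_real (periodicity_mean thue_morse n - real n * ?L n))
        \<le> 4 * norm (complex_of_real (ln (real n)))"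
      unfolding norm_of_real using ln_ge[OF n] by simp
    then show "norm (of_real (periodicity_mean thue_morse n) - of_nat n * complex_of_real (?L n))
      \<le> 4 * norm (complex_of_real (ln (real n)))" by simp
  qed
qed

end
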